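(* Let $\beta\in\mathbb{C}\setminus\{0\}$ be a scale descriptor and let $\rho,\rho'\in\mathcal{P}$ be two shape descriptors. Suppose $\rho$ and $\rho'$ are equivalent via $\rho'=g\rho$, where $g\in\Gamma$ is one of the actions $I,T,T^{-1},S,T^{-1}S,TS,TST,ST,ST^{-1},STS$. Then all the scale descriptors that satisfy the scale condition with $\beta$ are: 1. $\pm\beta$, if $g$ is $I$, $T$ or $T^{-1}$; 2. $\exp(\pm i\,\mathrm{Arg}(\rho))\,\beta$, if $g$ is $S$, $T^{-1}S$ or $TS$; 3. $\exp(\pm i\,\mathrm{Arg}(1+\rho))\,\beta$, if $g$ is $TST$ or $ST$; 4. $\exp(\pm i\,\mathrm{Arg}(1-\rho))\,\beta$, if $g$ is $ST^{-1}$ or $STS$.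
   Context: The set of shape descriptors is $\mathcal{P}=\{z\in\mathbb{C} : |z|\ge 1,\ |\mathrm{Re}(z)|\le \tfrac12,\ \mathrm{Im}(z)>0\}$; scale descriptors are elements of $\mathbb{C}\setminus\{0\}$. The modular group $\Gamma$ is the group, under composition, of transformations of the upper half plane $\mathcal{H}=\{z:\mathrm{Im}(z)>0\}$ of the form $z\mapsto \frac{k_3+k_4z}{k_1+k_2z}$ with $k_1,k_2,k_3,k_4\in\mathbb{Z}$ and $k_1k_4-k_2k_3=1$; such a transformation is associated with the matrix $\begin{bmatrix}k_4&k_3\\k_2&k_1\end{bmatrix}$, and $\Gamma$ is identified with $\mathrm{PSL}_2(\mathbb{Z})$. Here $I$ is the identity, $T:z\mapsto z+1$, $S:z\mapsto-1/z$, and products denote composition (rightmost applied first). Two shape descriptors $\rho,\rho'$ are equivalent if $\rho'=\frac{k_3+k_4\rho}{k_1+k_2\rho}$ for some such integers, i.e. $\rho'=g\rho$ for the corresponding $g\in\Gamma$. The scale condition between scale descriptors $\beta$ and $\beta'$, for the action $g$ with coefficients $k_1,k_2,k_3,k_4$ relating $\rho$ to $\rho'$, is $\beta'=e^{i\,\mathrm{Arg}(k_1+k_2\rho)}\beta$. $\mathrm{Arg}(z)$ denotes the argument of a nonzero complex number $z$.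
   Formalization: In items 2–4 the sign is moved outside the exponential: the solutions are ±exp(i Arg(w))β with w = ρ, 1+ρ, 1−ρ, instead of exp(±i Arg(w))β, which fails for ρ = e^{iπ/3}, g = S, β = 1. *)

theory Defs
  imports "HOL-Analysis.Analysis" "HOL-Algebra.Group"
begin

definition upper_half_plane :: "complex set" where
  "upper_half_plane = {z. Im z > 0}"

definition shape_descriptors :: "complex set" where
  "shape_descriptors = {z. cmod z \<ge> 1 \<and> \<bar>Re z\<bar> \<le> 1/2 \<and> Im z > 0}"

definition scale_descriptors :: "complex set" where
  "scale_descriptors = - {0}"

text \<open>
  The transformation with coefficients \<open>k1, k2, k3, k4\<close>, associated with the matrix with rows
  \<open>(k4, k3)\<close> and \<open>(k2, k1)\<close>. Transformations are restricted to the upper half plane (and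
  \<^const>\<open>undefined\<close> outside), so that equality of functions is equality of transformations
  of the upper half plane; quadruples differing by a global sign give the same transformation.
\<close>

definition modular_map :: "int \<Rightarrow> int \<Rightarrow> int \<Rightarrow> int \<Rightarrow> complex \<Rightarrow> complex" where
  "modular_map k1 k2 k3 k4 =
     (\<lambda>z\<in>upper_half_plane. (of_int k3 + of_int k4 * z) / (of_int k1 + of_int k2 * z))"

definition modular_group :: "(complex \<Rightarrow> complex) monoid" ("\<Gamma>") where
  "\<Gamma> = \<lparr>carrier = {modular_map k1 k2 k3 k4 | k1 k2 k3 k4. k1 * k4 - k2 * k3 = 1},
        mult = (\<lambda>f g. compose upper_half_plane f g),
        one = (\<lambda>z\<in>upper_half_plane. z)\<rparr>"

definition trT :: "complex \<Rightarrow> complex" where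
  "trT = (\<lambda>z\<in>upper_half_plane. z + 1)"

definition trS :: "complex \<Rightarrow> complex" where
  "trS = (\<lambda>z\<in>upper_half_plane. - 1 / z)"

definition equivalent_via :: "(complex \<Rightarrow> complex) \<Rightarrow> complex \<Rightarrow> complex \<Rightarrow> bool" where
  "equivalent_via g \<rho> \<rho>' \<longleftrightarrow> g \<in> carrier \<Gamma> \<and> \<rho>' = g \<rho>"

text \<open>
  The coefficients of an element \<open>g\<close> of the modular group are determined only up to a global
  sign. A scale descriptor \<open>\<beta>'\<close> satisfies the scale condition with \<open>\<beta>\<close> for \<open>g\<close> if it does so for
  some choice of coefficients of \<open>g\<close>; this is the origin of the two solutions in each case.
\<close>

definition scale_condition ::
    "(complex \<Rightarrow> complex) \<Rightarrow> complex \<Rightarrow> complex \<Rightarrow> complex \<Rightarrow> bool" where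
  "scale_condition g \<rho> \<beta> \<beta>' \<longleftrightarrow>
     (\<exists>k1 k2 k3 k4 :: int. k1 * k4 - k2 * k3 = 1 \<and> g = modular_map k1 k2 k3 k4 \<and>
        \<beta>' = exp (\<i> * of_real (Arg (of_int k1 + of_int k2 * \<rho>))) * \<beta>)"

lemma denominator_nonzero:
  fixes k1 k2 k3 k4 :: int
  assumes "k1 * k4 - k2 * k3 = 1" "Im z > 0"
  shows "of_int k1 + of_int k2 * z \<noteq> 0"
proof
  assume *: "of_int k1 + of_int k2 * z = 0"
  then have "Im (of_int k1 + of_int k2 * z) = 0" by simp
  then have "k2 = 0" using assms(2) by simp
  with * have "k1 = 0" by simp
  with \<open>k2 = 0\<close> assms(1) show False by simp
qed

lemma modular_map_in_upper_half_plane: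
  assumes "k1 * k4 - k2 * k3 = 1" "z \<in> upper_half_plane"
  shows "modular_map k1 k2 k3 k4 z \<in> upper_half_plane"
proof -
  let ?d = "of_int k1 + of_int k2 * z" and ?n = "of_int k3 + of_int k4 * z"
  have z: "Im z > 0" using assms(2) by (simp add: upper_half_plane_def)
  have d: "?d \<noteq> 0" by (rule denominator_nonzero[OF assms(1) z])
  have "real_of_int (k1 * k4 - k2 * k3) = 1" using assms(1) by simp
  then have det: "real_of_int k1 * of_int k4 - of_int k2 * of_int k3 = 1" by simp
  have "Im (?n * cnj ?d) = (real_of_int k1 * of_int k4 - of_int k2 * of_int k3) * Im z"
    by (simp add: algebra_simps)
  then have "Im (?n * cnj ?d) = Im z" by (simp only: det)
  moreover have "?n / ?d = (?n * cnj ?d) / of_real ((cmod ?d)\<^sup>2)"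
    by (rule complex_div_cnj)
  ultimately have "Im (?n / ?d) = Im z / (cmod ?d)\<^sup>2"
    by (metis Im_divide_of_real)
  then have "Im (?n / ?d) > 0" using z d by simp
  then show ?thesis using assms(2) by (simp add: modular_map_def upper_half_plane_def)
qed

lemma compose_modular_map:
  assumes "k1 * k4 - k2 * k3 = 1" "l1 * l4 - l2 * l3 = 1"
  shows "compose upper_half_plane (modular_map k1 k2 k3 k4) (modular_map l1 l2 l3 l4) =
    modular_map (k1 * l1 + k2 * l3) (k1 * l2 + k2 * l4) (k3 * l1 + k4 * l3) (k3 * l2 + k4 * l4)"
proof
  fix z
  show "compose upper_half_plane (modular_map k1 k2 k3 k4) (modular_map l1 l2 l3 l4) z =
    modular_map (k1 * l1 + k2 * l3) (k1 * l2 + k2 * l4) (k3 * l1 + k4 * l3) (k3 * l2 + k4 * l4) z"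
  proof (cases "z \<in> upper_half_plane")
    case True
    let ?d = "of_int l1 + of_int l2 * z" and ?n = "of_int l3 + of_int l4 * z"
    have d: "?d \<noteq> 0"
      using True by (intro denominator_nonzero[OF assms(2)]) (simp add: upper_half_plane_def)
    have "a + b * (?n / ?d) = (a * ?d + b * ?n) / ?d" for a b
      using d by (simp add: divide_simps)
    then have "(of_int k3 + of_int k4 * (?n / ?d)) / (of_int k1 + of_int k2 * (?n / ?d))
        = (of_int k3 * ?d + of_int k4 * ?n) / (of_int k1 * ?d + of_int k2 * ?n)"
      using d by (simp only: divide_divide_times_eq) (simp add: mult.commute)
    also have "\<dots> = modular_map (k1 * l1 + k2 * l3) (k1 * l2 + k2 * l4)
        (k3 * l1 + k4 * l3) (k3 * l2 + k4 * l4) z"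
      using True by (simp add: modular_map_def algebra_simps)
    finally show ?thesis
      using True modular_map_in_upper_half_plane[OF assms(2) True]
      by (simp add: compose_def modular_map_def)
  qed (simp add: compose_def modular_map_def)
qed

lemma one_eq_modular_map: "\<one>\<^bsub>\<Gamma>\<^esub> = modular_map 1 0 0 1"
  by (auto simp: modular_group_def modular_map_def)

lemma trT_eq_modular_map: "trT = modular_map 1 0 1 1"
  by (auto simp: trT_def modular_map_def add.commute)

lemma trS_eq_modular_map: "trS = modular_map 0 1 (-1) 0"
  by (auto simp: trS_def modular_map_def)

lemma mult_modular_map:
  assumes "k1 * k4 - k2 * k3 = 1" "l1 * l4 - l2 * l3 = 1"
  shows "modular_map k1 k2 k3 k4 \<otimes>\<^bsub>\<Gamma>\<^esub> modular_map l1 l2 l3 l4 =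
    modular_map (k1 * l1 + k2 * l3) (k1 * l2 + k2 * l4) (k3 * l1 + k4 * l3) (k3 * l2 + k4 * l4)"
  using compose_modular_map[OF assms] by (simp add: modular_group_def)

lemma modular_map_in_group:
  "k1 * k4 - k2 * k3 = 1 \<Longrightarrow> modular_map k1 k2 k3 k4 \<in> carrier \<Gamma>"
  by (auto simp: modular_group_def)

lemma modular_group_cases:
  assumes "g \<in> carrier \<Gamma>"
  obtains k1 k2 k3 k4 where "g = modular_map k1 k2 k3 k4" "k1 * k4 - k2 * k3 = 1"
  using assms by (auto simp: modular_group_def)

lemma det_mult:
  fixes k1 k2 k3 k4 l1 l2 l3 l4 :: int
  assumes "k1 * k4 - k2 * k3 = 1" "l1 * l4 - l2 * l3 = 1"
  shows "(k1 * l1 + k2 * l3) * (k3 * l2 + k4 * l4) - (k1 * l2 + k2 * l4) * (k3 * l1 + k4 * l3) = 1"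
proof -
  have "(k1 * l1 + k2 * l3) * (k3 * l2 + k4 * l4) - (k1 * l2 + k2 * l4) * (k3 * l1 + k4 * l3)
      = (k1 * k4 - k2 * k3) * (l1 * l4 - l2 * l3)" by algebra
  then show ?thesis using assms by simp
qed

lemma group_modular_group: "group \<Gamma>"
proof (rule groupI)
  fix x y assume "x \<in> carrier \<Gamma>" "y \<in> carrier \<Gamma>"
  then show "x \<otimes>\<^bsub>\<Gamma>\<^esub> y \<in> carrier \<Gamma>"
    by (elim modular_group_cases) (simp add: mult_modular_map modular_map_in_group det_mult)
next
  show "\<one>\<^bsub>\<Gamma>\<^esub> \<in> carrier \<Gamma>"
    unfolding one_eq_modular_map by (rule modular_map_in_group) simp
next
  fix x y z assume "x \<in> carrier \<Gamma>" "y \<in> carrier \<Gamma>" "z \<in> carrier \<Gamma>"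
  then show "x \<otimes>\<^bsub>\<Gamma>\<^esub> y \<otimes>\<^bsub>\<Gamma>\<^esub> z = x \<otimes>\<^bsub>\<Gamma>\<^esub> (y \<otimes>\<^bsub>\<Gamma>\<^esub> z)"
    by (elim modular_group_cases) (simp add: mult_modular_map det_mult algebra_simps)
next
  fix x assume "x \<in> carrier \<Gamma>"
  then show "\<one>\<^bsub>\<Gamma>\<^esub> \<otimes>\<^bsub>\<Gamma>\<^esub> x = x"
    by (elim modular_group_cases) (simp add: one_eq_modular_map mult_modular_map)
next
  fix x assume "x \<in> carrier \<Gamma>"
  then obtain k1 k2 k3 k4 where k: "x = modular_map k1 k2 k3 k4" "k1 * k4 - k2 * k3 = 1"
    by (rule modular_group_cases)
  have k': "k4 * k1 - (- k2) * (- k3) = 1" using k(2) by (simp add: algebra_simps)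
  have "modular_map k4 (- k2) (- k3) k1 \<otimes>\<^bsub>\<Gamma>\<^esub> x = \<one>\<^bsub>\<Gamma>\<^esub>"
    using k(2) unfolding k(1) one_eq_modular_map
    by (subst mult_modular_map[OF k' k(2)]) (simp add: algebra_simps)
  then show "\<exists>y\<in>carrier \<Gamma>. y \<otimes>\<^bsub>\<Gamma>\<^esub> x = \<one>\<^bsub>\<Gamma>\<^esub>"
    using modular_map_in_group[OF k'] by blast
qed

end

theory Submission
  imports Defs
begin

text \<open>
  Two integer quadruples of determinant 1 define the same transformation iff they agree up to a
  global sign. Since \<open>exp (i Arg w)\<close> is \<open>w / |w|\<close>, the scale condition for a transformation with
  denominator \<open>w\<close> at \<open>\<rho>\<close> therefore has exactly the solutions \<open>exp (i Arg w) \<beta>\<close> and its negative,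
  and these depend on \<open>w\<close> only up to sign. It remains to read off the denominator of each word
  from its matrix.
\<close>

text \<open>Clearing denominators turns equality of the maps into an identity of quadratic
  polynomials, which makes the rows \<open>(l1, l2)\<close> and \<open>(k1, k2)\<close> proportional
  with a unit factor. Only the denominator row is tracked, as the scale condition sees nothing
  else.\<close>

lemma modular_map_eq_imp:
  assumes k: "k1 * k4 - k2 * k3 = 1" and l: "l1 * l4 - l2 * l3 = 1"
    and eq: "modular_map k1 k2 k3 k4 = modular_map l1 l2 l3 l4"
  shows "(l1 = k1 \<and> l2 = k2) \<or> (l1 = - k1 \<and> l2 = - k2)"
proof -
  have cross: "(of_int k3 + of_int k4 * z) * (of_int l1 + of_int l2 * z)
      = (of_int l3 + of_int l4 * z) * (of_int k1 + of_int k2 * z)" if z: "Im z > 0" for z :: complex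
    using fun_cong[OF eq, of z] z denominator_nonzero[OF k z] denominator_nonzero[OF l z]
    by (simp add: modular_map_def upper_half_plane_def frac_eq_eq)
  text \<open>Comparing coefficients of these quadratic polynomials needs only two points.\<close>
  have "real_of_int (k3 * l1 - k4 * l2) = of_int (l3 * k1 - l4 * k2)"
    and 1: "real_of_int (k3 * l2 + k4 * l1) = of_int (l3 * k2 + l4 * k1)"
    using cross[of \<i>] by (simp_all add: complex_eq_iff)
  moreover have "real_of_int (k3 * l1 - 4 * (k4 * l2)) = of_int (l3 * k1 - 4 * (l4 * k2))"
    using cross[of "2 * \<i>"] by (simp add: complex_eq_iff)
  ultimately have c0: "k3 * l1 = l3 * k1" and c2: "k4 * l2 = l4 * k2"
    and c1: "k3 * l2 + k4 * l1 = l3 * k2 + l4 * k1"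
    by linarith+
  have par: "l1 * k2 - l2 * k1 = 0"
  proof -
    \<comment> \<open>Inserting the determinant 1 gives a cubic expression equal to
      \<open>k1 * k2\<close> times \<open>c1\<close> minus \<open>k2 * k2\<close> times
      \<open>c0\<close> minus \<open>k1 * k1\<close> times \<open>c2\<close>.\<close>
    have "l1 * k2 - l2 * k1 = (l1 * k2 - l2 * k1) * (k1 * k4 - k2 * k3)" using k by simp
    also have "\<dots> = 0" using c0 c1 c2 by algebra
    finally show ?thesis .
  qed
  \<comment> \<open>Pairing \<open>(l1, l2) = a * (k1, k2)\<close> with \<open>(k4, - k3)\<close>
    forces this value, so the factor is an integer.\<close>
  define a where "a = l1 * k4 - l2 * k3"
  have l1: "l1 = a * k1" and l2: "l2 = a * k2"
    using k par unfolding a_def by algebra+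
  \<comment> \<open>The second determinant is divisible by \<open>a\<close>, hence \<open>a\<close>
    is a unit of the integers.\<close>
  have "a * (k1 * l4 - k2 * l3) = 1" using l unfolding l1 l2 by (simp add: algebra_simps)
  then have "a = 1 \<or> a = - 1" by (auto simp: zmult_eq_1_iff)
  then show ?thesis using l1 l2 by auto
qed

lemma modular_map_uminus:
  "modular_map (- k1) (- k2) (- k3) (- k4) = modular_map k1 k2 k3 k4"
proof -
  have "(- of_int k3 - of_int k4 * z) / (- of_int k1 - of_int k2 * z)
      = (of_int k3 + of_int k4 * z) / (of_int k1 + of_int k2 * z)" for z :: complex
    using minus_divide_divide[of "of_int k3 + of_int k4 * z" "of_int k1 + of_int k2 * z"] by simp
  then show ?thesis by (simp add: modular_map_def)
qed

text \<open>For nonzero \<open>w\<close> the exponential is \<open>sgn w\<close>, an odd function.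
  At 0 the claim fails because \<open>Arg 0 = 0\<close>.\<close>

lemma exp_Arg_uminus:
  assumes "w \<noteq> 0"
  shows "exp (\<i> * of_real (Arg (- w))) = - exp (\<i> * of_real (Arg w))"
  using assms cis_Arg[of w] cis_Arg[of "- w"] by (simp add: cis_conv_exp sgn_minus)

text \<open>Any one quadruple representing the map determines all solutions. The free sign of
  \<open>w\<close> allows \<open>1 - \<rho>\<close> to stand for the denominator
  \<open>-1 + \<rho>\<close>.\<close>

lemma scale_condition_modular_map:
  assumes k: "k1 * k4 - k2 * k3 = 1" and \<rho>: "Im \<rho> > 0" and \<beta>: "\<beta> \<in> scale_descriptors"
    and w: "w = of_int k1 + of_int k2 * \<rho> \<or> w = - (of_int k1 + of_int k2 * \<rho>)"
  shows "{\<beta>' \<in> scale_descriptors. scale_condition (modular_map k1 k2 k3 k4) \<rho> \<beta> \<beta>'}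
    = {exp (\<i> * of_real (Arg w)) * \<beta>, - exp (\<i> * of_real (Arg w)) * \<beta>}" (is "?L = ?R")
proof -
  let ?d = "of_int k1 + of_int k2 * \<rho>"
  let ?e = "exp (\<i> * of_real (Arg ?d))"
  have d: "?d \<noteq> 0" by (rule denominator_nonzero[OF k \<rho>])
  have neg: "exp (\<i> * of_real (Arg (- of_int k1 - of_int k2 * \<rho>))) = - ?e"
    using exp_Arg_uminus[OF d] by simp
  have R: "?R = {?e * \<beta>, - ?e * \<beta>}" using w neg by auto
  have "?L = {?e * \<beta>, - ?e * \<beta>}"
  proof (intro equalityI subsetI)
    fix \<beta>' assume "\<beta>' \<in> ?L"
    then obtain l1 l2 l3 l4 where l: "l1 * l4 - l2 * l3 = 1"
      and eq: "modular_map k1 k2 k3 k4 = modular_map l1 l2 l3 l4"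
      and \<beta>': "\<beta>' = exp (\<i> * of_real (Arg (of_int l1 + of_int l2 * \<rho>))) * \<beta>"
      unfolding scale_condition_def by blast
    from modular_map_eq_imp[OF k l eq] show "\<beta>' \<in> {?e * \<beta>, - ?e * \<beta>}"
      using \<beta>' neg by auto
  next
    fix \<beta>' assume "\<beta>' \<in> {?e * \<beta>, - ?e * \<beta>}"
    then consider "\<beta>' = ?e * \<beta>" | "\<beta>' = - ?e * \<beta>" by blast
    then have "scale_condition (modular_map k1 k2 k3 k4) \<rho> \<beta> \<beta>'"
    proof cases
      case 1
      then show ?thesis using k unfolding scale_condition_def by blast
    next
      case 2
      \<comment> \<open>The negated quadruple represents the same map and reverses the sign of the
        denominator, which yields the second solution.\<close>
      have "(- k1) * (- k4) - (- k2) * (- k3) = 1" using k by simp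
      moreover have "\<beta>' = exp (\<i> * of_real (Arg (of_int (- k1) + of_int (- k2) * \<rho>))) * \<beta>"
        using 2 neg by simp
      ultimately show ?thesis
        unfolding scale_condition_def using modular_map_uminus[of k1 k2 k3 k4] by metis
    qed
    moreover have "\<beta>' \<in> scale_descriptors"
      using \<open>\<beta>' \<in> {?e * \<beta>, - ?e * \<beta>}\<close> \<beta> by (auto simp: scale_descriptors_def)
    ultimately show "\<beta>' \<in> ?L" by simp
  qed
  with R show ?thesis by simp
qed

lemma inv_trT_eq_modular_map: "inv\<^bsub>\<Gamma>\<^esub> trT = modular_map 1 0 (-1) 1"
proof (rule group.inv_equality[OF group_modular_group])
  show "modular_map 1 0 (-1) 1 \<otimes>\<^bsub>\<Gamma>\<^esub> trT = \<one>\<^bsub>\<Gamma>\<^esub>"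
    by (simp add: trT_eq_modular_map one_eq_modular_map mult_modular_map)
qed (simp_all add: trT_eq_modular_map modular_map_in_group)

theorem proposition3p7:
  fixes \<beta> \<rho> \<rho>' :: complex and g :: "complex \<Rightarrow> complex"
  assumes "\<beta> \<in> scale_descriptors"
    and "\<rho> \<in> shape_descriptors" and "\<rho>' \<in> shape_descriptors"
    and "equivalent_via g \<rho> \<rho>'"
    and "g \<in> {\<one>\<^bsub>\<Gamma>\<^esub>, trT, inv\<^bsub>\<Gamma>\<^esub> trT, trS, inv\<^bsub>\<Gamma>\<^esub> trT \<otimes>\<^bsub>\<Gamma>\<^esub> trS, trT \<otimes>\<^bsub>\<Gamma>\<^esub> trS,
              trT \<otimes>\<^bsub>\<Gamma>\<^esub> trS \<otimes>\<^bsub>\<Gamma>\<^esub> trT, trS \<otimes>\<^bsub>\<Gamma>\<^esub> trT, trS \<otimes>\<^bsub>\<Gamma>\<^esub> inv\<^bsub>\<Gamma>\<^esub> trT,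
              trS \<otimes>\<^bsub>\<Gamma>\<^esub> trT \<otimes>\<^bsub>\<Gamma>\<^esub> trS}"
  shows "(g \<in> {\<one>\<^bsub>\<Gamma>\<^esub>, trT, inv\<^bsub>\<Gamma>\<^esub> trT} \<longrightarrow>
            {\<beta>' \<in> scale_descriptors. scale_condition g \<rho> \<beta> \<beta>'} = {\<beta>, - \<beta>})
       \<and> (g \<in> {trS, inv\<^bsub>\<Gamma>\<^esub> trT \<otimes>\<^bsub>\<Gamma>\<^esub> trS, trT \<otimes>\<^bsub>\<Gamma>\<^esub> trS} \<longrightarrow>
            {\<beta>' \<in> scale_descriptors. scale_condition g \<rho> \<beta> \<beta>'} =
              {exp (\<i> * of_real (Arg \<rho>)) * \<beta>, - exp (\<i> * of_real (Arg \<rho>)) * \<beta>})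
       \<and> (g \<in> {trT \<otimes>\<^bsub>\<Gamma>\<^esub> trS \<otimes>\<^bsub>\<Gamma>\<^esub> trT, trS \<otimes>\<^bsub>\<Gamma>\<^esub> trT} \<longrightarrow>
            {\<beta>' \<in> scale_descriptors. scale_condition g \<rho> \<beta> \<beta>'} =
              {exp (\<i> * of_real (Arg (1 + \<rho>))) * \<beta>, - exp (\<i> * of_real (Arg (1 + \<rho>))) * \<beta>})
       \<and> (g \<in> {trS \<otimes>\<^bsub>\<Gamma>\<^esub> inv\<^bsub>\<Gamma>\<^esub> trT, trS \<otimes>\<^bsub>\<Gamma>\<^esub> trT \<otimes>\<^bsub>\<Gamma>\<^esub> trS} \<longrightarrow>
            {\<beta>' \<in> scale_descriptors. scale_condition g \<rho> \<beta> \<beta>'} =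
              {exp (\<i> * of_real (Arg (1 - \<rho>))) * \<beta>, - exp (\<i> * of_real (Arg (1 - \<rho>))) * \<beta>})"
proof -
  have \<rho>: "Im \<rho> > 0" using assms(2) by (simp add: shape_descriptors_def)
  \<comment> \<open>These rules multiply each word out to a single \<open>modular_map\<close>. Since
    \<open>trT\<close> is rewritten inside \<open>inv\<close> first, the rule for the inverse needs
    it unfolded.\<close>
  note word_simps = one_eq_modular_map trT_eq_modular_map trS_eq_modular_map
    inv_trT_eq_modular_map[unfolded trT_eq_modular_map] mult_modular_map
  note solutions = scale_condition_modular_map[OF _ \<rho> assms(1)]
  have "{\<beta>' \<in> scale_descriptors. scale_condition g \<rho> \<beta> \<beta>'} = {\<beta>, - \<beta>}"
    if "g \<in> {\<one>\<^bsub>\<Gamma>\<^esub>, trT, inv\<^bsub>\<Gamma>\<^esub> trT}"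
  proof -
    \<comment> \<open>Translations have denominator 1, and \<open>Arg 1 = 0\<close>.\<close>
    have "\<exists>k3. g = modular_map 1 0 k3 1" using that by (auto simp: word_simps)
    then obtain k3 where "g = modular_map 1 0 k3 1" ..
    then show ?thesis using solutions[of 1 1 0 k3 1] by simp
  qed
  moreover have "{\<beta>' \<in> scale_descriptors. scale_condition g \<rho> \<beta> \<beta>'} =
      {exp (\<i> * of_real (Arg \<rho>)) * \<beta>, - exp (\<i> * of_real (Arg \<rho>)) * \<beta>}"
    if "g \<in> {trS, inv\<^bsub>\<Gamma>\<^esub> trT \<otimes>\<^bsub>\<Gamma>\<^esub> trS, trT \<otimes>\<^bsub>\<Gamma>\<^esub> trS}"
  proof -
    \<comment> \<open>A power of T on the left changes only the numerator; \<open>k4\<close> is its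
      exponent.\<close>
    have "\<exists>k4. g = modular_map 0 1 (- 1) k4" using that by (auto simp: word_simps)
    then obtain k4 where "g = modular_map 0 1 (- 1) k4" ..
    then show ?thesis using solutions[of 0 k4 1 "- 1" \<rho>] by simp
  qed
  moreover have "{\<beta>' \<in> scale_descriptors. scale_condition g \<rho> \<beta> \<beta>'} =
      {exp (\<i> * of_real (Arg (1 + \<rho>))) * \<beta>, - exp (\<i> * of_real (Arg (1 + \<rho>))) * \<beta>}"
    if "g \<in> {trT \<otimes>\<^bsub>\<Gamma>\<^esub> trS \<otimes>\<^bsub>\<Gamma>\<^esub> trT, trS \<otimes>\<^bsub>\<Gamma>\<^esub> trT}"
  proof -
    have "g = modular_map 1 1 0 1 \<or> g = modular_map 1 1 (- 1) 0"
      using that by (auto simp: word_simps)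
    then show ?thesis
      using solutions[of 1 1 1 0 "1 + \<rho>"] solutions[of 1 0 1 "- 1" "1 + \<rho>"] by auto
  qed
  moreover have "{\<beta>' \<in> scale_descriptors. scale_condition g \<rho> \<beta> \<beta>'} =
      {exp (\<i> * of_real (Arg (1 - \<rho>))) * \<beta>, - exp (\<i> * of_real (Arg (1 - \<rho>))) * \<beta>}"
    if "g \<in> {trS \<otimes>\<^bsub>\<Gamma>\<^esub> inv\<^bsub>\<Gamma>\<^esub> trT, trS \<otimes>\<^bsub>\<Gamma>\<^esub> trT \<otimes>\<^bsub>\<Gamma>\<^esub> trS}"
  proof -
    \<comment> \<open>Both denominators come out as \<open>\<rho> - 1\<close>, so the solutions are
      read off with the negative choice of \<open>w\<close>.\<close>
    have "g = modular_map (- 1) 1 (- 1) 0 \<or> g = modular_map (- 1) 1 0 (- 1)"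
      using that by (auto simp: word_simps)
    then show ?thesis
      using solutions[of "- 1" 0 1 "- 1" "1 - \<rho>"] solutions[of "- 1" "- 1" 1 0 "1 - \<rho>"] by auto
  qed
  ultimately show ?thesis by blast
qed

end
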